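(* Consider the perturbed (Boussinesq) ODE $y''+y-\epsilon(x+1+y^2)=0$ for $y=y(x)$ with small parameter $\epsilon$. Let $$X=\big(\xi^0(x,y)+\epsilon\xi^1(x,y)\big)\frac{\partial}{\partial x}+\big(\eta^0(x,y)+\epsilon\eta^1(x,y)\big)\frac{\partial}{\partial y},$$ where $\xi^0,\xi^1,\eta^0,\eta^1$ are smooth real functions on $\mathbb{R}^2$. Then $X$ is a first-order Baikov-Gazizov-Ibragimov (BGI) approximate point symmetry of this ODE if and only if there are real constants $C_5,C_6,C_7,a_1,\dots,a_8$ such that $$\xi^0=C_5,\qquad \eta^0=C_6\sin x+C_7\cos x,$$ $$\xi^1=-a_1y\cos x+a_2y\sin x+a_3\sin 2x-a_4\cos 2x+a_5-\tfrac{4C_6}{3}\cos x+\tfrac{4C_7}{3}\sin x,$$ $$\eta^1=a_1y^2\sin x+a_2y^2\cos x+a_3y\cos 2x+a_4y\sin 2x+a_6\sin x+a_7\cos x+a_8y+\tfrac{2C_6}{3}y\sin x+\tfrac{2C_7}{3}y\cos x+C_5.$$ Consequently, the approximate point symmetries are spanned by the eight trivial ones $\epsilon X_j^0$, $j=1,\dots,8$, where $$X_1^0=y^2\sin x\,\partial_y-y\cos x\,\partial_x,\quad X_2^0=y^2\cos x\,\partial_y+y\sin x\,\partial_x,\quad X_3^0=y\cos 2x\,\partial_y+\sin 2x\,\partial_x,$$ $$X_4^0=y\sin 2x\,\partial_y-\cos 2x\,\partial_x,\quad X_5^0=\partial_x,\quad X_6^0=\sin x\,\partial_y,\quad X_7^0=\cos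 x\,\partial_y,\quad X_8^0=y\,\partial_y$$ are the point symmetries of the unperturbed equation $y''+y=0$, together with the three nontrivial ones $$\partial_x+\epsilon\,\partial_y,\qquad \sin x\,\partial_y+\epsilon\big(\tfrac23y\sin x\,\partial_y-\tfrac43\cos x\,\partial_x\big),\qquad \cos x\,\partial_y+\epsilon\big(\tfrac23y\cos x\,\partial_y+\tfrac43\sin x\,\partial_x\big).$$ In particular, as point symmetries, $X_5^0,X_6^0,X_7^0$ are stable, and $X_1^0,X_2^0,X_3^0,X_4^0,X_8^0$ are unstable.
   Context: For a vector field $X=\xi\,\partial_x+\eta\,\partial_y$ with $\xi,\eta$ functions of $(x,y)$, its second prolongation is $X^{(2)}=\xi\,\partial_x+\eta\,\partial_y+\eta^{(1)}\partial_{y'}+\eta^{(2)}\partial_{y''}$, where $\eta^{(1)}=D\eta-y'D\xi$, $\eta^{(2)}=D\eta^{(1)}-y''D\xi$, and $D=\partial_x+y'\partial_y+y''\partial_{y'}+\cdots$ is the total derivative. Let $F=F_0+\epsilon F_1$ with $F_0=y''+y$ and $F_1=-(x+1+y^2)$. The generator $X=X^0+\epsilon X^1$, where $X^i=\xi^i(x,y)\partial_x+\eta^i(x,y)\partial_y$, is a (first-order) BGI approximate point symmetry of $F=0$ if $$\big(X^{0(2)}+\epsilon X^{1(2)}\big)(F_0+\epsilon F_1)\Big|_{F_0+\epsilon F_1=0}=O(\epsilon^2),$$ that is, after substituting $y''=-y+\epsilon(x+1+y^2)$, the coefficients of $\epsilon^0$ and $\epsilon^1$ vanish identically in $(x,y,y')$.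 A point symmetry $X^0$ of $y''+y=0$ is called stable (as a point symmetry) if there is a point generator $X^1$ such that $X^0+\epsilon X^1$ is a BGI approximate point symmetry of the perturbed ODE; otherwise it is called unstable. *)

theory Defs
  imports
    "HOL-Analysis.Analysis"
    "HOL-Library.Landau_Symbols"
    "HOL-Library.Function_Algebras"
begin

(* Pointwise real vector space structure on functions; together with the library instance for
   products it makes the pairs of coefficient functions below a real vector space, so that the
   library's span applies to them. *)
instantiation "fun" :: (type, real_vector) real_vector
begin

definition scaleR_fun :: "real \<Rightarrow> ('a \<Rightarrow> 'b) \<Rightarrow> 'a \<Rightarrow> 'b"
  where "scaleR_fun c f = (\<lambda>x. c *\<^sub>R f x)"

instance
  by standard (simp_all add: scaleR_fun_def fun_eq_iff algebra_simps)

end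

primrec C_k :: "nat \<Rightarrow> (real \<Rightarrow> real \<Rightarrow> real) \<Rightarrow> bool" where
  "C_k 0 f \<longleftrightarrow> continuous_on UNIV (\<lambda>(x, y). f x y)"
| "C_k (Suc k) f \<longleftrightarrow>
     (\<exists>fx fy. (\<forall>x y. ((\<lambda>s. f s y) has_real_derivative fx x y) (at x)) \<and>
              (\<forall>x y. ((\<lambda>t. f x t) has_real_derivative fy x y) (at y)) \<and>
              C_k k fx \<and> C_k k fy)"

definition smooth :: "(real \<Rightarrow> real \<Rightarrow> real) \<Rightarrow> bool"
  where "smooth f \<longleftrightarrow> (\<forall>k. C_k k f)"

(* The pair (\<xi>, \<eta>) stands for the vector field \<xi>(x,y) d/dx + \<eta>(x,y) d/dy. *)
type_synonym vfield = "(real \<Rightarrow> real \<Rightarrow> real) \<times> (real \<Rightarrow> real \<Rightarrow> real)"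

definition point_generator :: "vfield \<Rightarrow> bool"
  where "point_generator X \<longleftrightarrow> smooth (fst X) \<and> smooth (snd X)"

(* The total derivative D = d/dx + y' d/dy + y'' d/dy' + ... on functions of (x, y), and on
   functions of (x, y, y').  The omitted terms of D vanish on such functions.
   Throughout, y1 and y2 are the jet coordinates y' and y''. *)
definition D0 :: "(real \<Rightarrow> real \<Rightarrow> real) \<Rightarrow> real \<Rightarrow> real \<Rightarrow> real \<Rightarrow> real"
  where "D0 f x y y1 = deriv (\<lambda>s. f s y) x + y1 * deriv (\<lambda>s. f x s) y"

definition D1 :: "(real \<Rightarrow> real \<Rightarrow> real \<Rightarrow> real) \<Rightarrow> real \<Rightarrow> real \<Rightarrow> real \<Rightarrow> real \<Rightarrow> real"
  where "D1 f x y y1 y2 =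
    deriv (\<lambda>s. f s y y1) x + y1 * deriv (\<lambda>s. f x s y1) y + y2 * deriv (\<lambda>s. f x y s) y1"

definition eta1 :: "vfield \<Rightarrow> real \<Rightarrow> real \<Rightarrow> real \<Rightarrow> real"
  where "eta1 X x y y1 = D0 (snd X) x y y1 - y1 * D0 (fst X) x y y1"

definition eta2 :: "vfield \<Rightarrow> real \<Rightarrow> real \<Rightarrow> real \<Rightarrow> real \<Rightarrow> real"
  where "eta2 X x y y1 y2 = D1 (eta1 X) x y y1 y2 - y2 * D0 (fst X) x y y1"

type_synonym jet2_fun = "real \<Rightarrow> real \<Rightarrow> real \<Rightarrow> real \<Rightarrow> real"

(* The second prolongation of X, as a differential operator on functions of (x, y, y', y''). *)
definition prolong2 :: "vfield \<Rightarrow> jet2_fun \<Rightarrow> jet2_fun"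
  where "prolong2 X F x y y1 y2 =
    fst X x y * deriv (\<lambda>s. F s y y1 y2) x +
    snd X x y * deriv (\<lambda>s. F x s y1 y2) y +
    eta1 X x y y1 * deriv (\<lambda>s. F x y s y2) y1 +
    eta2 X x y y1 y2 * deriv (\<lambda>s. F x y y1 s) y2"

definition F0 :: jet2_fun
  where "F0 x y y1 y2 = y2 + y"

definition F1 :: jet2_fun
  where "F1 x y y1 y2 = - (x + 1 + y\<^sup>2)"

lemma perturbed_solved_form:
  "F0 x y y1 y2 + \<epsilon> * F1 x y y1 y2 = 0 \<longleftrightarrow> y2 = - y + \<epsilon> * (x + 1 + y\<^sup>2)"
  by (auto simp: F0_def F1_def algebra_simps)

definition point_symmetry0 :: "vfield \<Rightarrow> bool"
  where "point_symmetry0 X \<longleftrightarrow> point_generator X \<and>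
    (\<forall>x y y1 y2. F0 x y y1 y2 = 0 \<longrightarrow> prolong2 X F0 x y y1 y2 = 0)"

(* The pair (X0, X1) stands for X0 + \<epsilon> X1.  For fixed (x, y, y') the expression below is a
   polynomial in \<epsilon>, so being O(\<epsilon>^2) for \<epsilon> -> 0 means that its coefficients of \<epsilon>^0 and \<epsilon>^1
   vanish. *)
definition BGI_symmetry :: "vfield \<times> vfield \<Rightarrow> bool"
  where "BGI_symmetry X \<longleftrightarrow> point_generator (fst X) \<and> point_generator (snd X) \<and>
    (\<forall>x y y1.
      (\<lambda>\<epsilon>. let F = (\<lambda>x y y1 y2. F0 x y y1 y2 + \<epsilon> * F1 x y y1 y2);
                y2 = - y + \<epsilon> * (x + 1 + y\<^sup>2)
            in prolong2 (fst X) F x y y1 y2 + \<epsilon> * prolong2 (snd X) F x y y1 y2)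
      \<in> O[at 0](\<lambda>\<epsilon>. \<epsilon>\<^sup>2))"

definition stable_symmetry :: "vfield \<Rightarrow> bool"
  where "stable_symmetry X0 \<longleftrightarrow> point_symmetry0 X0 \<and>
    (\<exists>X1. point_generator X1 \<and> BGI_symmetry (X0, X1))"

definition unstable_symmetry :: "vfield \<Rightarrow> bool"
  where "unstable_symmetry X0 \<longleftrightarrow> point_symmetry0 X0 \<and>
    \<not> (\<exists>X1. point_generator X1 \<and> BGI_symmetry (X0, X1))"

definition X_1 :: vfield where "X_1 = (\<lambda>x y. - y * cos x, \<lambda>x y. y\<^sup>2 * sin x)"
definition X_2 :: vfield where "X_2 = (\<lambda>x y. y * sin x, \<lambda>x y. y\<^sup>2 * cos x)"
definition X_3 :: vfield where "X_3 = (\<lambda>x y. sin (2 * x), \<lambda>x y. y * cos (2 * x))"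
definition X_4 :: vfield where "X_4 = (\<lambda>x y. - cos (2 * x), \<lambda>x y. y * sin (2 * x))"
definition X_5 :: vfield where "X_5 = (\<lambda>x y. 1, \<lambda>x y. 0)"
definition X_6 :: vfield where "X_6 = (\<lambda>x y. 0, \<lambda>x y. sin x)"
definition X_7 :: vfield where "X_7 = (\<lambda>x y. 0, \<lambda>x y. cos x)"
definition X_8 :: vfield where "X_8 = (\<lambda>x y. 0, \<lambda>x y. y)"

end

theory Submission
  imports Defs
begin

text \<open>
  Put \<open>D(X) = \<eta> + eta2 X\<close>, evaluated at \<open>y'' = - y\<close>. Since \<open>eta2 X\<close> is affine in \<open>y''\<close>, the
  invariance condition for \<open>X0 + \<epsilon> X1\<close> is a quadratic polynomial in \<open>\<epsilon>\<close>, and its first two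
  coefficients say that \<open>D(X0) = 0\<close> and that \<open>D(X1)\<close> equals a source term built from \<open>X0\<close>
  (lemma \<open>BGI_symmetry_iff_determining\<close>).

  \<open>D(X)\<close> is a cubic polynomial in \<open>y'\<close>, while the right-hand sides of both equations are affine
  in \<open>y'\<close>. The vanishing of the cubic and quadratic coefficients forces \<open>\<xi> = A + y B\<close> and
  \<open>\<eta> = P + y Q + y\<^sup>2 B'\<close> with functions \<open>A, B, P, Q\<close> of \<open>x\<close> alone (lemma
  \<open>determining_affine_imp_quadratic\<close>), and the rest becomes a system of linear differential
  equations for these four functions. For the source \<open>c5 + 2 y p(x)\<close>, where
  \<open>p(x) = c6 sin x + c7 cos x\<close>, the system reads \<open>B'' + B = 0\<close>, \<open>P'' + P = c5\<close>, \<open>2 Q' = A''\<close>,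
  \<open>Q'' + 2 A' = 2 p\<close>. So \<open>A' - 4/3 p\<close> oscillates with frequency 2, and the solutions form the
  eight-parameter family \<open>sol_field\<close> (lemma \<open>determining_eq_iff_sol_field\<close>).

  With zero source this family is the Lie algebra of the unperturbed equation. For the perturbed
  equation, the source of \<open>X0\<close> is compatible with the form of \<open>D(X1)\<close> only under two
  conditions: the coefficient of \<open>y'\<close> contains \<open>3 (x + 1 + y\<^sup>2) B\<close> but must be affine in \<open>y\<close>,
  whence \<open>B = 0\<close>; and then the coefficient of \<open>y\<^sup>2\<close> must vanish, whence \<open>Q + 2 A' = 0\<close>. Only
  \<open>X0 = (c5, c6 sin x + c7 cos x)\<close> survives, and its source is exactly \<open>c5 + 2 y p(x)\<close>. Hence
  \<open>X1\<close> is a \<open>sol_field\<close> with the same \<open>c5, c6, c7\<close> (lemma \<open>BGI_symmetry_iff\<close>), and the spans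
  and the stability assertions are read off.
\<close>

section \<open>Smooth functions of two variables\<close>

definition dx :: "(real \<Rightarrow> real \<Rightarrow> real) \<Rightarrow> real \<Rightarrow> real \<Rightarrow> real"
  where "dx f x y = deriv (\<lambda>s. f s y) x"

definition dy :: "(real \<Rightarrow> real \<Rightarrow> real) \<Rightarrow> real \<Rightarrow> real \<Rightarrow> real"
  where "dy f x y = deriv (\<lambda>t. f x t) y"

lemma dx_eqI: "((\<lambda>s. f s y) has_real_derivative d) (at x) \<Longrightarrow> dx f x y = d"
  unfolding dx_def by (rule DERIV_imp_deriv)

lemma dy_eqI: "((\<lambda>t. f x t) has_real_derivative d) (at y) \<Longrightarrow> dy f x y = d"
  unfolding dy_def by (rule DERIV_imp_deriv)

lemma C_k_Suc_partials:
  assumes "C_k (Suc k) f"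
  shows "((\<lambda>s. f s y) has_real_derivative dx f x y) (at x)"
    and "((\<lambda>t. f x t) has_real_derivative dy f x y) (at y)"
    and "C_k k (dx f)" and "C_k k (dy f)"
proof -
  obtain fx fy where *:
    "\<And>x y. ((\<lambda>s. f s y) has_real_derivative fx x y) (at x)"
    "\<And>x y. ((\<lambda>t. f x t) has_real_derivative fy x y) (at y)"
    "C_k k fx" "C_k k fy"
    using assms by auto
  have "dx f = fx" "dy f = fy"
    using * by (auto intro!: ext dx_eqI dy_eqI)
  with * show "((\<lambda>s. f s y) has_real_derivative dx f x y) (at x)"
    and "((\<lambda>t. f x t) has_real_derivative dy f x y) (at y)"
    and "C_k k (dx f)" and "C_k k (dy f)"
    by auto
qed

lemma smooth_has_dx: "smooth f \<Longrightarrow> ((\<lambda>s. f s y) has_real_derivative dx f x y) (at x)"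
  and smooth_has_dy: "smooth f \<Longrightarrow> ((\<lambda>t. f x t) has_real_derivative dy f x y) (at y)"
  and smooth_dx: "smooth f \<Longrightarrow> smooth (dx f)"
  and smooth_dy: "smooth f \<Longrightarrow> smooth (dy f)"
  using C_k_Suc_partials unfolding smooth_def by blast+

text \<open>A class that contains the components of all solutions found below and is closed under
  partial derivatives.\<close>

inductive trig_poly :: "(real \<Rightarrow> real \<Rightarrow> real) \<Rightarrow> bool" where
  const: "trig_poly (\<lambda>x y. c)"
| snd: "trig_poly (\<lambda>x y. y)"
| sin: "trig_poly (\<lambda>x y. sin (w * x))"
| cos: "trig_poly (\<lambda>x y. cos (w * x))"
| add: "trig_poly f \<Longrightarrow> trig_poly g \<Longrightarrow> trig_poly (\<lambda>x y. f x y + g x y)"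
| mult: "trig_poly f \<Longrightarrow> trig_poly g \<Longrightarrow> trig_poly (\<lambda>x y. f x y * g x y)"

lemma trig_poly_sin1: "trig_poly (\<lambda>x y. sin x)"
  and trig_poly_cos1: "trig_poly (\<lambda>x y. cos x)"
  using trig_poly.sin[of 1] trig_poly.cos[of 1] by simp_all

lemma trig_poly_diff:
  assumes "trig_poly f" "trig_poly g"
  shows "trig_poly (\<lambda>x y. f x y - g x y)"
  using trig_poly.add[OF assms(1) trig_poly.mult[OF trig_poly.const[of "-1"] assms(2)]] by simp

lemmas trig_poly_intros = trig_poly.intros trig_poly_sin1 trig_poly_cos1 trig_poly_diff

lemma trig_poly_continuous: "trig_poly f \<Longrightarrow> continuous_on UNIV (\<lambda>(x, y). f x y)"
  by (induction rule: trig_poly.induct)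
    (auto simp: case_prod_unfold intro!: continuous_intros)

lemma trig_poly_partials:
  assumes "trig_poly f"
  shows "\<exists>fx fy. (\<forall>x y. ((\<lambda>s. f s y) has_real_derivative fx x y) (at x)) \<and>
                 (\<forall>x y. ((\<lambda>t. f x t) has_real_derivative fy x y) (at y)) \<and>
                 trig_poly fx \<and> trig_poly fy"
  using assms
proof (induction rule: trig_poly.induct)
  case (const c)
  show ?case
    by (intro exI[of _ "\<lambda>x y. 0"]) (auto intro: trig_poly_intros)
next
  case snd
  show ?case
    by (intro exI[of _ "\<lambda>x y. 0"] exI[of _ "\<lambda>x y. 1"]) (auto intro: trig_poly_intros)
next
  case (sin w)
  show ?case
    by (intro exI[of _ "\<lambda>x y. w * cos (w * x)"] exI[of _ "\<lambda>x y. 0"])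
      (auto intro!: trig_poly_intros derivative_eq_intros)
next
  case (cos w)
  have "trig_poly (\<lambda>x y. - w * sin (w * x))"
    by (intro trig_poly_intros)
  then show ?case
    by (intro exI[of _ "\<lambda>x y. - w * sin (w * x)"] exI[of _ "\<lambda>x y. 0"])
      (auto intro!: trig_poly.const derivative_eq_intros)
next
  case (add f g)
  then obtain fx fy gx gy where
    "\<And>x y. ((\<lambda>s. f s y) has_real_derivative fx x y) (at x)"
    "\<And>x y. ((\<lambda>t. f x t) has_real_derivative fy x y) (at y)"
    "\<And>x y. ((\<lambda>s. g s y) has_real_derivative gx x y) (at x)"
    "\<And>x y. ((\<lambda>t. g x t) has_real_derivative gy x y) (at y)"
    "trig_poly fx" "trig_poly fy" "trig_poly gx" "trig_poly gy"
    by blast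
  then show ?case
    by (intro exI[of _ "\<lambda>x y. fx x y + gx x y"] exI[of _ "\<lambda>x y. fy x y + gy x y"])
      (auto intro!: trig_poly_intros DERIV_add)
next
  case (mult f g)
  then obtain fx fy gx gy where
    "\<And>x y. ((\<lambda>s. f s y) has_real_derivative fx x y) (at x)"
    "\<And>x y. ((\<lambda>t. f x t) has_real_derivative fy x y) (at y)"
    "\<And>x y. ((\<lambda>s. g s y) has_real_derivative gx x y) (at x)"
    "\<And>x y. ((\<lambda>t. g x t) has_real_derivative gy x y) (at y)"
    "trig_poly fx" "trig_poly fy" "trig_poly gx" "trig_poly gy"
    by blast
  with mult.hyps show ?case
    by (intro exI[of _ "\<lambda>x y. fx x y * g x y + gx x y * f x y"]
          exI[of _ "\<lambda>x y. fy x y * g x y + gy x y * f x y"])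
      (auto intro!: trig_poly_intros DERIV_mult)
qed

text \<open>Closure of a whole class under partial derivatives gives smoothness by an induction in which
  products need no separate treatment: a direct product rule for \<^const>\<open>C_k\<close> would rest on
  \<^term>\<open>C_k (Suc k) f\<close> implying \<^term>\<open>C_k k f\<close>, that is, on the continuity of functions with
  continuous partial derivatives.\<close>

lemma trig_poly_smooth: "trig_poly f \<Longrightarrow> smooth f"
proof -
  have "trig_poly f \<Longrightarrow> C_k k f" for k
  proof (induction k arbitrary: f)
    case 0
    then show ?case by (simp add: trig_poly_continuous)
  next
    case (Suc k)
    then show ?case using trig_poly_partials[of f] by (simp only: C_k.simps) blast
  qed
  then show "trig_poly f \<Longrightarrow> smooth f" by (simp add: smooth_def)
qed


section \<open>Ordinary differential equations with constant coefficients\<close>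

text \<open>In the phase plane, rotating \<open>(w f, f')\<close> back by the angle \<open>w x\<close> stops the motion; the two
  conserved components are, up to the factor \<open>w\<close>, the amplitudes.\<close>

lemma harmonic_oscillator:
  fixes f f1 :: "real \<Rightarrow> real"
  assumes f: "\<And>x. (f has_real_derivative f1 x) (at x)"
    and f1: "\<And>x. (f1 has_real_derivative - (w\<^sup>2) * f x) (at x)"
    and w: "w \<noteq> 0"
  obtains a b where "\<And>x. f x = a * sin (w * x) + b * cos (w * x)"
proof -
  let ?u = "\<lambda>x. f x * sin (w * x) * w + f1 x * cos (w * x)"
  let ?v = "\<lambda>x. f x * cos (w * x) * w - f1 x * sin (w * x)"
  have "(?u has_real_derivative 0) (at x)" "(?v has_real_derivative 0) (at x)" for x
    by (auto intro!: derivative_eq_intros f f1 simp: algebra_simps power2_eq_square)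
  then have "\<exists>u. \<forall>x. ?u x = u" "\<exists>v. \<forall>x. ?v x = v"
    using DERIV_isconst_all[of ?u _ 0] DERIV_isconst_all[of ?v _ 0] by blast+
  then obtain u v where uv: "\<And>x. ?u x = u" "\<And>x. ?v x = v"
    by blast
  have ident: "(a * S * w + b * C) * S + (a * C * w - b * S) * C = a * w * (S\<^sup>2 + C\<^sup>2)"
    for a b S C :: real
    by (simp add: algebra_simps power2_eq_square)
  have "f x = (u / w) * sin (w * x) + (v / w) * cos (w * x)" for x
  proof -
    have "u * sin (w * x) + v * cos (w * x) = f x * w"
      using ident[of "f x" "sin (w * x)" "f1 x" "cos (w * x)"] unfolding uv by simp
    then have "f x = (u * sin (w * x) + v * cos (w * x)) / w"
      using w by (simp only: nonzero_mult_div_cancel_right not_False_eq_True)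
    then show ?thesis
      by (simp add: add_divide_distrib)
  qed
  then show thesis by (rule that)
qed

lemma eq_derivative_imp_differ_by_const:
  fixes f g :: "real \<Rightarrow> real"
  assumes "\<And>x. (f has_real_derivative d x) (at x)" "\<And>x. (g has_real_derivative d x) (at x)"
  obtains c where "\<And>x. f x = g x + c"
proof -
  have "((\<lambda>x. f x - g x) has_real_derivative 0) (at x)" for x
    by (rule derivative_eq_intros assms refl)+ simp
  then have "f x - g x = f 0 - g 0" for x
    using DERIV_isconst_all[of "\<lambda>x. f x - g x" x 0] by blast
  then have "f x = g x + (f 0 - g 0)" for x
    by (simp add: algebra_simps)
  then show thesis by (rule that)
qed

lemma constant_second_derivative:
  fixes f f1 :: "real \<Rightarrow> real"
  assumes f: "\<And>y. (f has_real_derivative f1 y) (at y)"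
    and f1: "\<And>y. (f1 has_real_derivative 2 * c) (at y)"
  shows "f y = f 0 + y * f1 0 + y\<^sup>2 * c"
proof -
  have "((\<lambda>y. 2 * c * y) has_real_derivative 2 * c) (at y)" for y
    by (auto intro!: derivative_eq_intros)
  then obtain b where b: "\<And>y. f1 y = 2 * c * y + b"
    using eq_derivative_imp_differ_by_const[OF f1] by blast
  have "((\<lambda>y. c * y\<^sup>2 + b * y) has_real_derivative f1 y) (at y)" for y
    by (auto intro!: derivative_eq_intros simp: b)
  then obtain a where "\<And>y. f y = c * y\<^sup>2 + b * y + a"
    using eq_derivative_imp_differ_by_const[OF f] by blast
  then show ?thesis using b[of 0] by (simp add: algebra_simps)
qed


section \<open>The determining equations\<close>

text \<open>Setting this expression to zero gives the determining equation of \<open>y'' + y = 0\<close>.\<close>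

definition determining :: "vfield \<Rightarrow> real \<Rightarrow> real \<Rightarrow> real \<Rightarrow> real"
  where "determining X x y y1 = snd X x y + eta2 X x y y1 (- y)"

text \<open>The slope of \<open>eta2 X\<close> as a function of \<open>y''\<close>.\<close>

definition acceleration_coeff :: "vfield \<Rightarrow> real \<Rightarrow> real \<Rightarrow> real \<Rightarrow> real"
  where "acceleration_coeff X x y y1 = dy (snd X) x y - 2 * dx (fst X) x y - 3 * y1 * dy (fst X) x y"

lemma eta1_eq:
  "eta1 X x y y1 = dx (snd X) x y + y1 * (dy (snd X) x y - dx (fst X) x y) - y1\<^sup>2 * dy (fst X) x y"
  by (simp add: eta1_def D0_def dx_def dy_def algebra_simps power2_eq_square)

lemma deriv_eta1_y1:
  "deriv (\<lambda>s. eta1 X x y s) y1 = dy (snd X) x y - dx (fst X) x y - 2 * y1 * dy (fst X) x y"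
  unfolding eta1_eq by (rule DERIV_imp_deriv) (auto intro!: derivative_eq_intros)

lemma eta2_shift:
  "eta2 X x y y1 (y2 + d) = eta2 X x y y1 y2 + d * acceleration_coeff X x y y1"
  unfolding eta2_def D1_def deriv_eta1_y1 acceleration_coeff_def
  by (simp add: D0_def dx_def dy_def algebra_simps)

text \<open>The mixed second derivatives are kept apart, so that no symmetry of second derivatives is
  involved. Once \<open>\<xi>\<close> is known to be affine in \<open>y\<close>, its mixed derivatives can be computed and agree.\<close>

lemma determining_eqI:
  assumes "((\<lambda>s. dx (snd X) s y) has_real_derivative \<eta>xx) (at x)"
    and "((\<lambda>s. dy (snd X) s y) has_real_derivative \<eta>yx) (at x)"
    and "((\<lambda>s. dx (fst X) s y) has_real_derivative \<xi>xx) (at x)"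
    and "((\<lambda>s. dy (fst X) s y) has_real_derivative \<xi>yx) (at x)"
    and "((\<lambda>t. dx (snd X) x t) has_real_derivative \<eta>xy) (at y)"
    and "((\<lambda>t. dy (snd X) x t) has_real_derivative \<eta>yy) (at y)"
    and "((\<lambda>t. dx (fst X) x t) has_real_derivative \<xi>xy) (at y)"
    and "((\<lambda>t. dy (fst X) x t) has_real_derivative \<xi>yy) (at y)"
  shows "determining X x y y1 =
      (snd X x y + \<eta>xx - y * (dy (snd X) x y - 2 * dx (fst X) x y))
    + y1 * (\<eta>xy + \<eta>yx - \<xi>xx + 3 * y * dy (fst X) x y)
    + y1\<^sup>2 * (\<eta>yy - \<xi>xy - \<xi>yx)
    - y1 ^ 3 * \<xi>yy"
proof -
  have 1: "deriv (\<lambda>s. eta1 X s y y1) x = \<eta>xx + y1 * (\<eta>yx - \<xi>xx) - y1\<^sup>2 * \<xi>yx"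
    unfolding eta1_eq
    by (rule DERIV_imp_deriv) (rule derivative_eq_intros assms refl | simp)+
  have 2: "deriv (\<lambda>t. eta1 X x t y1) y = \<eta>xy + y1 * (\<eta>yy - \<xi>xy) - y1\<^sup>2 * \<xi>yy"
    unfolding eta1_eq
    by (rule DERIV_imp_deriv) (rule derivative_eq_intros assms refl | simp)+
  show ?thesis
    unfolding determining_def eta2_def D1_def 1 2 deriv_eta1_y1
    by (simp add: D0_def dx_def[symmetric] dy_def[symmetric] algebra_simps
        power2_eq_square power3_eq_cube)
qed

definition quadratic_field ::
    "(real \<Rightarrow> real) \<Rightarrow> (real \<Rightarrow> real) \<Rightarrow> (real \<Rightarrow> real) \<Rightarrow> (real \<Rightarrow> real) \<Rightarrow> (real \<Rightarrow> real) \<Rightarrow> vfield"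
  where "quadratic_field A B P Q R = (\<lambda>x y. A x + y * B x, \<lambda>x y. P x + y * Q x + y\<^sup>2 * R x)"

text \<open>The choice \<open>R = B'\<close> makes the quadratic coefficient in \<open>y'\<close> vanish; the cubic one vanishes
  because \<open>\<xi>\<close> is affine in \<open>y\<close>.\<close>

lemma quadratic_field_equations:
  assumes A: "\<And>x. (A has_real_derivative A1 x) (at x)"
      "\<And>x. (A1 has_real_derivative A2 x) (at x)"
    and B: "\<And>x. (B has_real_derivative B1 x) (at x)"
      "\<And>x. (B1 has_real_derivative B2 x) (at x)"
      "\<And>x. (B2 has_real_derivative B3 x) (at x)"
    and P: "\<And>x. (P has_real_derivative P1 x) (at x)"
      "\<And>x. (P1 has_real_derivative P2 x) (at x)"
    and Q: "\<And>x. (Q has_real_derivative Q1 x) (at x)"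
      "\<And>x. (Q1 has_real_derivative Q2 x) (at x)"
  defines "X \<equiv> quadratic_field A B P Q B1"
  shows determining_quadratic_field: "determining X x y y1 =
      (P2 x + P x) + y * (Q2 x + 2 * A1 x) + y\<^sup>2 * (B3 x + B1 x)
      + y1 * (2 * Q1 x - A2 x + 3 * y * (B2 x + B x))"
    and acceleration_coeff_quadratic_field:
      "acceleration_coeff X x y y1 = Q x - 2 * A1 x - 3 * y1 * B x"
proof -
  have X: "fst X = (\<lambda>x y. A x + y * B x)" "snd X = (\<lambda>x y. P x + y * Q x + y\<^sup>2 * B1 x)"
    by (simp_all add: X_def quadratic_field_def)
  note d = A B P Q
  have partials: "dx (fst X) = (\<lambda>x y. A1 x + y * B1 x)"
    "dy (fst X) = (\<lambda>x y. B x)"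
    "dx (snd X) = (\<lambda>x y. P1 x + y * Q1 x + y\<^sup>2 * B2 x)"
    "dy (snd X) = (\<lambda>x y. Q x + 2 * y * B1 x)"
    unfolding X by (intro ext dx_eqI dy_eqI; (rule derivative_eq_intros d refl | simp)+)+
  have "determining X x y y1 =
      (snd X x y + (P2 x + y * Q2 x + y\<^sup>2 * B3 x) - y * (dy (snd X) x y - 2 * dx (fst X) x y))
    + y1 * ((Q1 x + 2 * y * B2 x) + (Q1 x + 2 * y * B2 x) - (A2 x + y * B2 x)
            + 3 * y * dy (fst X) x y)
    + y1\<^sup>2 * (2 * B1 x - B1 x - B1 x) - y1 ^ 3 * 0"
    by (rule determining_eqI; unfold partials; (rule derivative_eq_intros d refl | simp)+)
  then show "determining X x y y1 =
      (P2 x + P x) + y * (Q2 x + 2 * A1 x) + y\<^sup>2 * (B3 x + B1 x)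
      + y1 * (2 * Q1 x - A2 x + 3 * y * (B2 x + B x))"
    unfolding partials by (simp add: X algebra_simps power2_eq_square)
  show "acceleration_coeff X x y y1 = Q x - 2 * A1 x - 3 * y1 * B x"
    unfolding acceleration_coeff_def partials by simp
qed

lemma cubic_eq_affine:
  fixes c0 c1 c2 c3 r0 r1 :: real
  assumes "\<And>t. c0 + t * c1 + t\<^sup>2 * c2 - t ^ 3 * c3 = r0 + t * r1"
  shows "c0 = r0" "c1 = r1" "c2 = 0" "c3 = 0"
  using assms[of 0] assms[of 1] assms[of "-1"] assms[of 2] by auto

lemma quadratic_eq_quadratic:
  fixes c0 c1 c2 r0 r1 r2 :: real
  assumes "\<And>t. c0 + t * c1 + t\<^sup>2 * c2 = r0 + t * r1 + t\<^sup>2 * r2"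
  shows "c0 = r0" "c1 = r1" "c2 = r2"
  using assms[of 0] assms[of 1] assms[of "-1"] by auto

lemma smooth_iterated_deriv:
  fixes c :: real
  assumes "smooth f"
  defines "g \<equiv> \<lambda>x. f x c"
  shows "(g has_real_derivative deriv g x) (at x)"
    and "(deriv g has_real_derivative deriv (deriv g) x) (at x)"
    and "(deriv (deriv g) has_real_derivative deriv (deriv (deriv g)) x) (at x)"
proof -
  have "deriv g = (\<lambda>x. dx f x c)"
    and "deriv (\<lambda>x. dx f x c) = (\<lambda>x. dx (dx f) x c)"
    and "deriv (\<lambda>x. dx (dx f) x c) = (\<lambda>x. dx (dx (dx f)) x c)"
    by (simp_all add: g_def dx_def fun_eq_iff)
  then show "(g has_real_derivative deriv g x) (at x)"
    and "(deriv g has_real_derivative deriv (deriv g) x) (at x)"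
    and "(deriv (deriv g) has_real_derivative deriv (deriv (deriv g)) x) (at x)"
    using smooth_has_dx[OF assms(1), of c x] smooth_has_dx[OF smooth_dx, OF assms(1), of c x]
      smooth_has_dx[OF smooth_dx, OF smooth_dx, OF assms(1), of c x]
    by (simp_all add: g_def)
qed

text \<open>Taylor coefficients at \<open>y = 0\<close>. Reading off the functions of \<open>x\<close> in this way makes their
  smoothness immediate.\<close>

definition xi_coeff0 :: "vfield \<Rightarrow> real \<Rightarrow> real" where "xi_coeff0 X = (\<lambda>x. fst X x 0)"
definition xi_coeff1 :: "vfield \<Rightarrow> real \<Rightarrow> real" where "xi_coeff1 X = (\<lambda>x. dy (fst X) x 0)"
definition eta_coeff0 :: "vfield \<Rightarrow> real \<Rightarrow> real" where "eta_coeff0 X = (\<lambda>x. snd X x 0)"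
definition eta_coeff1 :: "vfield \<Rightarrow> real \<Rightarrow> real" where "eta_coeff1 X = (\<lambda>x. dy (snd X) x 0)"

lemma taylor_coeff_derivs:
  assumes "point_generator X" and "g \<in> {xi_coeff0 X, xi_coeff1 X, eta_coeff0 X, eta_coeff1 X}"
  shows "(g has_real_derivative deriv g x) (at x)"
    and "(deriv g has_real_derivative deriv (deriv g) x) (at x)"
    and "(deriv (deriv g) has_real_derivative deriv (deriv (deriv g)) x) (at x)"
proof -
  obtain f where "smooth f" "g = (\<lambda>x. f x 0)"
    using assms smooth_dy[of "fst X"] smooth_dy[of "snd X"]
    unfolding point_generator_def xi_coeff0_def xi_coeff1_def eta_coeff0_def eta_coeff1_def
    by blast
  then show "(g has_real_derivative deriv g x) (at x)"
    and "(deriv g has_real_derivative deriv (deriv g) x) (at x)"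
    and "(deriv (deriv g) has_real_derivative deriv (deriv (deriv g)) x) (at x)"
    using smooth_iterated_deriv by blast+
qed

text \<open>The cubic coefficient in \<open>y'\<close> is \<open>- \<xi>\<^sub>y\<^sub>y\<close>, so \<open>\<xi>\<close> is affine in \<open>y\<close>; then the quadratic
  coefficient gives \<open>\<eta>\<^sub>y\<^sub>y = 2 B'\<close>, which fixes \<open>\<eta>\<close> up to its first two Taylor coefficients. The
  remaining equations are a comparison of the coefficients of \<open>1\<close> and \<open>y'\<close>.\<close>

lemma determining_affine_imp_quadratic:
  fixes X :: vfield
  assumes gen: "point_generator X"
    and eq: "\<And>x y y1. determining X x y y1 = R0 x y + y1 * R1 x y"
  defines "A \<equiv> xi_coeff0 X" and "B \<equiv> xi_coeff1 X"
    and "P \<equiv> eta_coeff0 X" and "Q \<equiv> eta_coeff1 X"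
  shows "X = quadratic_field A B P Q (deriv B)"
    and "R0 x y = (deriv (deriv P) x + P x) + y * (deriv (deriv Q) x + 2 * deriv A x)
        + y\<^sup>2 * (deriv (deriv (deriv B)) x + deriv B x)"
    and "R1 x y = 2 * deriv Q x - deriv (deriv A) x + 3 * y * (deriv (deriv B) x + B x)"
proof -
  obtain \<xi> \<eta> where X: "X = (\<xi>, \<eta>)" by (cases X)
  have sm: "smooth \<xi>" "smooth \<eta>"
    using assms(1) by (simp_all add: X point_generator_def)
  note \<xi>x = smooth_dx[OF sm(1)] and \<xi>y = smooth_dy[OF sm(1)]
    and \<eta>x = smooth_dx[OF sm(2)] and \<eta>y = smooth_dy[OF sm(2)]
  have "determining X x y y1 =
      (\<eta> x y + dx (dx \<eta>) x y - y * (dy \<eta> x y - 2 * dx \<xi> x y))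
    + y1 * (dy (dx \<eta>) x y + dx (dy \<eta>) x y - dx (dx \<xi>) x y + 3 * y * dy \<xi> x y)
    + y1\<^sup>2 * (dy (dy \<eta>) x y - dy (dx \<xi>) x y - dx (dy \<xi>) x y)
    - y1 ^ 3 * dy (dy \<xi>) x y" for x y y1
    using determining_eqI[where X = X and x = x and y = y, unfolded X fst_conv snd_conv, OF
        smooth_has_dx[OF \<eta>x] smooth_has_dx[OF \<eta>y] smooth_has_dx[OF \<xi>x] smooth_has_dx[OF \<xi>y]
        smooth_has_dy[OF \<eta>x] smooth_has_dy[OF \<eta>y] smooth_has_dy[OF \<xi>x] smooth_has_dy[OF \<xi>y]]
    unfolding X .
  note cubic = cubic_eq_affine[OF trans[OF sym[OF this] eq]]
  note derivs = taylor_coeff_derivs[OF gen]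
  have A: "(A has_real_derivative deriv A x) (at x)"
      "(deriv A has_real_derivative deriv (deriv A) x) (at x)"
    and B: "(B has_real_derivative deriv B x) (at x)"
      "(deriv B has_real_derivative deriv (deriv B) x) (at x)"
      "(deriv (deriv B) has_real_derivative deriv (deriv (deriv B)) x) (at x)"
    and P: "(P has_real_derivative deriv P x) (at x)"
      "(deriv P has_real_derivative deriv (deriv P) x) (at x)"
    and Q: "(Q has_real_derivative deriv Q x) (at x)"
      "(deriv Q has_real_derivative deriv (deriv Q) x) (at x)" for x
    unfolding A_def B_def P_def Q_def by (intro derivs; simp)+
  have coeffs: "A = (\<lambda>x. \<xi> x 0)" "B = (\<lambda>x. dy \<xi> x 0)"
    "P = (\<lambda>x. \<eta> x 0)" "Q = (\<lambda>x. dy \<eta> x 0)"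
    unfolding A_def B_def P_def Q_def
    by (simp_all add: X xi_coeff0_def xi_coeff1_def eta_coeff0_def eta_coeff1_def)
  have "(dy \<xi> x has_real_derivative 2 * 0) (at y)" for x y
    using smooth_has_dy[OF smooth_dy[OF sm(1)], of x y] cubic(4) by simp
  then have taylor_xi: "\<xi> x y = \<xi> x 0 + y * dy \<xi> x 0 + y\<^sup>2 * 0" for x y
    using constant_second_derivative[of "\<xi> x" "dy \<xi> x" 0] smooth_has_dy[OF sm(1)] by blast
  have \<xi>: "\<xi> = (\<lambda>x y. A x + y * B x)"
    unfolding fun_eq_iff coeffs(1,2) by (intro allI, subst taylor_xi) simp
  have "dx \<xi> = (\<lambda>x y. deriv A x + y * deriv B x)" "dy \<xi> = (\<lambda>x y. B x)"
    unfolding \<xi> by (intro ext dx_eqI dy_eqI; (rule derivative_eq_intros A B refl | simp)+)+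
  then have "dy (dx \<xi>) x y = deriv B x" "dx (dy \<xi>) x y = deriv B x" for x y
    by (auto intro!: dx_eqI dy_eqI derivative_eq_intros B)
  with cubic(3) have "dy (dy \<eta>) x y = 2 * deriv B x" for x y
    by (simp add: algebra_simps)
  then have "(dy \<eta> x has_real_derivative 2 * deriv B x) (at y)" for x y
    using smooth_has_dy[OF smooth_dy[OF sm(2)], of x y] by simp
  then have taylor_eta: "\<eta> x y = \<eta> x 0 + y * dy \<eta> x 0 + y\<^sup>2 * deriv B x" for x y
    using constant_second_derivative[of "\<eta> x" "dy \<eta> x" "deriv B x"] smooth_has_dy[OF sm(2)]
    by blast
  have \<eta>: "\<eta> = (\<lambda>x y. P x + y * Q x + y\<^sup>2 * deriv B x)"
    unfolding fun_eq_iff coeffs(3,4) by (intro allI, subst taylor_eta) simp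
  show XQ: "X = quadratic_field A B P Q (deriv B)"
    by (simp add: X quadratic_field_def \<xi>[symmetric] \<eta>[symmetric])
  note det = determining_quadratic_field[OF A B P Q, folded XQ]
  have aff: "R0 x y + y1 * R1 x y =
      ((deriv (deriv P) x + P x) + y * (deriv (deriv Q) x + 2 * deriv A x)
        + y\<^sup>2 * (deriv (deriv (deriv B)) x + deriv B x))
      + y1 * (2 * deriv Q x - deriv (deriv A) x + 3 * y * (deriv (deriv B) x + B x))" for x y y1
    using eq[of x y y1] det[of x y y1] by simp
  show "R0 x y = (deriv (deriv P) x + P x) + y * (deriv (deriv Q) x + 2 * deriv A x)
      + y\<^sup>2 * (deriv (deriv (deriv B)) x + deriv B x)"
    using aff[of x y 0] by simp
  show "R1 x y = 2 * deriv Q x - deriv (deriv A) x + 3 * y * (deriv (deriv B) x + B x)"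
    using aff[of x y 1] aff[of x y 0]
    by (simp only: mult_1 mult_zero_left add_0_right add_left_cancel)
qed


section \<open>Solving the determining equations\<close>

text \<open>The parameters \<open>a1, \<dots>, a8\<close> are the coordinates in the symmetry algebra of \<open>y'' + y = 0\<close>, and
  \<open>c5, c6, c7\<close> are the amplitudes of the source \<open>c5 + 2 y (c6 sin x + c7 cos x)\<close>.\<close>

definition sol_field :: "real \<Rightarrow> real \<Rightarrow> real \<Rightarrow> real \<Rightarrow> real \<Rightarrow> real \<Rightarrow> real \<Rightarrow> real \<Rightarrow>
    real \<Rightarrow> real \<Rightarrow> real \<Rightarrow> vfield"
  where "sol_field c5 c6 c7 a1 a2 a3 a4 a5 a6 a7 a8 =
   (\<lambda>x y. - a1 * y * cos x + a2 * y * sin x + a3 * sin (2 * x) - a4 * cos (2 * x) + a5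
          - 4 * c6 / 3 * cos x + 4 * c7 / 3 * sin x,
    \<lambda>x y. a1 * y\<^sup>2 * sin x + a2 * y\<^sup>2 * cos x + a3 * y * cos (2 * x)
          + a4 * y * sin (2 * x) + a6 * sin x + a7 * cos x + a8 * y
          + 2 * c6 / 3 * y * sin x + 2 * c7 / 3 * y * cos x + c5)"

lemma sol_field_quadratic: "sol_field c5 c6 c7 a1 a2 a3 a4 a5 a6 a7 a8 = quadratic_field
    (\<lambda>x. a3 * sin (2 * x) - a4 * cos (2 * x) + a5 + 4/3 * (c7 * sin x - c6 * cos x))
    (\<lambda>x. a2 * sin x - a1 * cos x)
    (\<lambda>x. a6 * sin x + a7 * cos x + c5)
    (\<lambda>x. a3 * cos (2 * x) + a4 * sin (2 * x) + a8 + 2/3 * (c6 * sin x + c7 * cos x))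
    (\<lambda>x. a2 * cos x + a1 * sin x)"
  by (simp add: sol_field_def quadratic_field_def fun_eq_iff algebra_simps)

lemma point_generator_sol_field: "point_generator (sol_field c5 c6 c7 a1 a2 a3 a4 a5 a6 a7 a8)"
  unfolding point_generator_def sol_field_def fst_conv snd_conv power2_eq_square
  by (intro conjI trig_poly_smooth trig_poly_intros)

lemma sol_field_equations:
  fixes c5 c6 c7 a1 a2 a3 a4 a5 a6 a7 a8 :: real
  defines "X \<equiv> sol_field c5 c6 c7 a1 a2 a3 a4 a5 a6 a7 a8"
  shows determining_sol_field:
      "determining X x y y1 = c5 + 2 * y * (c6 * sin x + c7 * cos x)"
    and acceleration_coeff_sol_field: "acceleration_coeff X x y y1 =
      a8 - 3 * (a3 * cos (2 * x) + a4 * sin (2 * x)) - 2 * (c6 * sin x + c7 * cos x)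
      - 3 * y1 * (a2 * sin x - a1 * cos x)"
proof -
  let ?A = "\<lambda>x. a3 * sin (2 * x) - a4 * cos (2 * x) + a5 + 4/3 * (c7 * sin x - c6 * cos x)"
  let ?A1 = "\<lambda>x. 2 * a3 * cos (2 * x) + 2 * a4 * sin (2 * x) + 4/3 * (c7 * cos x + c6 * sin x)"
  let ?A2 = "\<lambda>x. 4 * a4 * cos (2 * x) - 4 * a3 * sin (2 * x) + 4/3 * (c6 * cos x - c7 * sin x)"
  let ?B = "\<lambda>x. a2 * sin x - a1 * cos x"
  let ?B1 = "\<lambda>x. a2 * cos x + a1 * sin x"
  let ?B2 = "\<lambda>x. a1 * cos x - a2 * sin x"
  let ?B3 = "\<lambda>x. - a2 * cos x - a1 * sin x"
  let ?P = "\<lambda>x. a6 * sin x + a7 * cos x + c5"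
  let ?P1 = "\<lambda>x. a6 * cos x - a7 * sin x"
  let ?P2 = "\<lambda>x. - a6 * sin x - a7 * cos x"
  let ?Q = "\<lambda>x. a3 * cos (2 * x) + a4 * sin (2 * x) + a8 + 2/3 * (c6 * sin x + c7 * cos x)"
  let ?Q1 = "\<lambda>x. 2 * a4 * cos (2 * x) - 2 * a3 * sin (2 * x) + 2/3 * (c6 * cos x - c7 * sin x)"
  let ?Q2 = "\<lambda>x. - 4 * a3 * cos (2 * x) - 4 * a4 * sin (2 * x) - 2/3 * (c6 * sin x + c7 * cos x)"
  have d: "(?A has_real_derivative ?A1 x) (at x)" "(?A1 has_real_derivative ?A2 x) (at x)"
    "(?B has_real_derivative ?B1 x) (at x)" "(?B1 has_real_derivative ?B2 x) (at x)"
    "(?B2 has_real_derivative ?B3 x) (at x)"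
    "(?P has_real_derivative ?P1 x) (at x)" "(?P1 has_real_derivative ?P2 x) (at x)"
    "(?Q has_real_derivative ?Q1 x) (at x)" "(?Q1 has_real_derivative ?Q2 x) (at x)" for x
    by (auto intro!: derivative_eq_intros simp: algebra_simps)
  note eqs = quadratic_field_equations[OF d, folded sol_field_quadratic X_def]
  show "determining X x y y1 = c5 + 2 * y * (c6 * sin x + c7 * cos x)"
    unfolding eqs(1) by (simp add: algebra_simps)
  show "acceleration_coeff X x y y1 =
      a8 - 3 * (a3 * cos (2 * x) + a4 * sin (2 * x)) - 2 * (c6 * sin x + c7 * cos x)
      - 3 * y1 * (a2 * sin x - a1 * cos x)"
    unfolding eqs(2) by (simp add: algebra_simps)
qed

text \<open>The equations for \<open>B\<close> and \<open>P\<close> decouple. Eliminating \<open>Q\<close> from the other two gives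
  \<open>A''' + 4 A' = 4 p\<close> with \<open>p(x) = c6 sin x + c7 cos x\<close>, which has the particular solution
  \<open>A' = 4/3 p\<close> because \<open>p'' = - p\<close>.\<close>

lemma determining_eq_iff_sol_field:
  assumes gen: "point_generator X"
  shows "(\<forall>x y y1. determining X x y y1 = c5 + 2 * y * (c6 * sin x + c7 * cos x)) \<longleftrightarrow>
         (\<exists>a1 a2 a3 a4 a5 a6 a7 a8. X = sol_field c5 c6 c7 a1 a2 a3 a4 a5 a6 a7 a8)"
proof
  assume "\<forall>x y y1. determining X x y y1 = c5 + 2 * y * (c6 * sin x + c7 * cos x)"
  then have eq: "determining X x y y1 = (c5 + 2 * y * (c6 * sin x + c7 * cos x)) + y1 * 0" for x y y1
    by simp
  define A B P Q where "A = xi_coeff0 X" and "B = xi_coeff1 X"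
    and "P = eta_coeff0 X" and "Q = eta_coeff1 X"
  note coeff_defs = this
  note nf = determining_affine_imp_quadratic[OF gen eq, folded coeff_defs]
  note X = nf(1) and R0 = nf(2) and R1 = nf(3)
  note derivs = taylor_coeff_derivs(1,2)[OF gen, folded coeff_defs]
  have A: "(A has_real_derivative deriv A x) (at x)"
      "(deriv A has_real_derivative deriv (deriv A) x) (at x)"
    and B: "(B has_real_derivative deriv B x) (at x)"
      "(deriv B has_real_derivative deriv (deriv B) x) (at x)"
    and P: "(P has_real_derivative deriv P x) (at x)"
      "(deriv P has_real_derivative deriv (deriv P) x) (at x)"
    and Q: "(Q has_real_derivative deriv Q x) (at x)"
      "(deriv Q has_real_derivative deriv (deriv Q) x) (at x)" for x
    by (intro derivs; simp)+
  have "c5 + y * (2 * (c6 * sin x + c7 * cos x)) + y\<^sup>2 * 0 =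
        (deriv (deriv P) x + P x) + y * (deriv (deriv Q) x + 2 * deriv A x)
        + y\<^sup>2 * (deriv (deriv (deriv B)) x + deriv B x)" for x y
    using R0[where x = x and y = y] by (simp add: algebra_simps)
  note R0' = quadratic_eq_quadratic[OF this]
  have A2: "deriv (deriv A) x = 2 * deriv Q x" for x
    using R1[of x 0] by simp
  have "deriv (deriv B) x = - (1\<^sup>2) * B x" for x
    using R1[of x 0] R1[of x 1] by simp
  then obtain a2 b1 where "\<And>x. B x = a2 * sin (1 * x) + b1 * cos (1 * x)"
    using harmonic_oscillator[of B "deriv B" 1] B by auto
  then obtain a1 where Beq: "B = (\<lambda>x. a2 * sin x - a1 * cos x)"
    using that[of "- b1"] by (auto simp: fun_eq_iff)
  have B1eq: "deriv B = (\<lambda>x. a2 * cos x + a1 * sin x)"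
    unfolding Beq by (intro ext DERIV_imp_deriv) (auto intro!: derivative_eq_intros)
  have "((\<lambda>x. P x - c5) has_real_derivative deriv P x) (at x)"
    "(deriv P has_real_derivative - (1\<^sup>2) * (P x - c5)) (at x)" for x
    using P[of x] R0'(1)[of x] by (auto intro!: derivative_eq_intros)
  then obtain a6 a7 where "\<And>x. P x - c5 = a6 * sin (1 * x) + a7 * cos (1 * x)"
    using harmonic_oscillator[OF _ _ one_neq_zero] by blast
  then have Peq: "P = (\<lambda>x. a6 * sin x + a7 * cos x + c5)"
    by (simp add: fun_eq_iff algebra_simps)
  \<comment> \<open>the homogeneous part of \<open>A'\<close>; its derivative \<open>G1\<close> is written with \<open>A'' = 2 Q'\<close>\<close>
  define G where "G = (\<lambda>x. deriv A x - 4/3 * (c6 * sin x + c7 * cos x))"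
  define G1 where "G1 = (\<lambda>x. 2 * deriv Q x - 4/3 * (c6 * cos x - c7 * sin x))"
  have "(G has_real_derivative G1 x) (at x)" for x
    unfolding G_def G1_def by (rule derivative_eq_intros A refl | simp add: A2)+
  moreover have "(G1 has_real_derivative - (2\<^sup>2) * G x) (at x)" for x
    unfolding G_def G1_def
    by (rule derivative_eq_intros Q refl | simp)+ (use R0'(2)[of x] in \<open>simp add: field_simps\<close>)
  ultimately obtain g h where "\<And>x. G x = g * sin (2 * x) + h * cos (2 * x)"
    using harmonic_oscillator[OF _ _ zero_neq_numeral[symmetric]] by blast
  then obtain a3 a4 where "\<And>x. G x = 2 * a3 * cos (2 * x) + 2 * a4 * sin (2 * x)"
    using that[of "h / 2" "g / 2"] by auto
  then have A1: "deriv A x =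
      2 * a3 * cos (2 * x) + 2 * a4 * sin (2 * x) + 4/3 * (c6 * sin x + c7 * cos x)" for x
    by (simp add: G_def algebra_simps)
  have "((\<lambda>x. a3 * sin (2 * x) - a4 * cos (2 * x) + 4/3 * (c7 * sin x - c6 * cos x))
      has_real_derivative deriv A x) (at x)" for x
    by (auto intro!: derivative_eq_intros simp: A1 algebra_simps)
  then obtain a5 where "\<And>x. A x =
      a3 * sin (2 * x) - a4 * cos (2 * x) + 4/3 * (c7 * sin x - c6 * cos x) + a5"
    using eq_derivative_imp_differ_by_const[OF A(1)] by blast
  then have Aeq: "A =
      (\<lambda>x. a3 * sin (2 * x) - a4 * cos (2 * x) + a5 + 4/3 * (c7 * sin x - c6 * cos x))"
    by (simp add: fun_eq_iff)
  have "((\<lambda>x. deriv A x / 2) has_real_derivative deriv Q x) (at x)" for x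
    using A2[of x] by (auto intro!: derivative_eq_intros A)
  then obtain a8 where "\<And>x. Q x = deriv A x / 2 + a8"
    using eq_derivative_imp_differ_by_const[OF Q(1)] by blast
  then have Qeq: "Q =
      (\<lambda>x. a3 * cos (2 * x) + a4 * sin (2 * x) + a8 + 2/3 * (c6 * sin x + c7 * cos x))"
    by (simp add: A1 fun_eq_iff)
  have "X = sol_field c5 c6 c7 a1 a2 a3 a4 a5 a6 a7 a8"
    unfolding X sol_field_quadratic B1eq unfolding Aeq Beq Peq Qeq ..
  then show "\<exists>a1 a2 a3 a4 a5 a6 a7 a8. X = sol_field c5 c6 c7 a1 a2 a3 a4 a5 a6 a7 a8"
    by blast
qed (auto simp: determining_sol_field)


section \<open>Symmetry conditions as determining equations\<close>

lemma point_symmetry0_iff_determining: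
  "point_symmetry0 X \<longleftrightarrow> point_generator X \<and> (\<forall>x y y1. determining X x y y1 = 0)"
proof -
  have "prolong2 X F0 x y y1 y2 = snd X x y + eta2 X x y y1 y2" for x y y1 y2
  proof -
    have "deriv (\<lambda>s. F0 s y y1 y2) x = 0" "deriv (\<lambda>s. F0 x s y1 y2) y = 1"
      "deriv (\<lambda>s. F0 x y s y2) y1 = 0" "deriv (\<lambda>s. F0 x y y1 s) y2 = 1"
      unfolding F0_def by (auto intro!: DERIV_imp_deriv derivative_eq_intros)
    then show ?thesis by (simp add: prolong2_def)
  qed
  moreover have "F0 x y y1 y2 = 0 \<longleftrightarrow> y2 = - y" for x y y1 y2
    by (auto simp: F0_def)
  ultimately show ?thesis
    by (simp add: point_symmetry0_def determining_def)
qed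

text \<open>The perturbation enters in two places: through the derivatives of \<open>F1\<close>, and through the
  shift of \<open>y''\<close> in \<open>eta2 X\<close>.\<close>

lemma prolong2_perturbed:
  "prolong2 X (\<lambda>x y y1 y2. F0 x y y1 y2 + \<epsilon> * F1 x y y1 y2) x y y1 (- y + \<epsilon> * g) =
    determining X x y y1
    + \<epsilon> * (g * acceleration_coeff X x y y1 - fst X x y - 2 * y * snd X x y)"
proof -
  have derivs: "deriv (\<lambda>s. F0 s y y1 y2 + \<epsilon> * F1 s y y1 y2) x = - \<epsilon>"
    "deriv (\<lambda>s. F0 x s y1 y2 + \<epsilon> * F1 x s y1 y2) y = 1 - 2 * \<epsilon> * y"
    "deriv (\<lambda>s. F0 x y s y2 + \<epsilon> * F1 x y s y2) y1 = 0"
    "deriv (\<lambda>s. F0 x y y1 s + \<epsilon> * F1 x y y1 s) y2 = 1" for y2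
    unfolding F0_def F1_def by (auto intro!: DERIV_imp_deriv derivative_eq_intros)
  show ?thesis
    unfolding prolong2_def derivs eta2_shift
    by (simp add: determining_def algebra_simps)
qed

lemma quadratic_bigo_square_iff:
  fixes a b c :: real
  shows "(\<lambda>e. a + b * e + c * e\<^sup>2) \<in> O[at 0](\<lambda>e. e\<^sup>2) \<longleftrightarrow> a = 0 \<and> b = 0"
proof
  assume "(\<lambda>e. a + b * e + c * e\<^sup>2) \<in> O[at 0](\<lambda>e. e\<^sup>2)"
  then obtain K where K: "eventually (\<lambda>e. \<bar>a + b * e + c * e\<^sup>2\<bar> \<le> K * e\<^sup>2) (at 0)"
    by (auto elim!: landau_o.bigE)
  have "((\<lambda>e. \<bar>a + b * e + c * e\<^sup>2\<bar>) \<longlongrightarrow> \<bar>a + b * 0 + c * 0\<^sup>2\<bar>) (at 0)"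
    "((\<lambda>e. K * e\<^sup>2) \<longlongrightarrow> K * 0\<^sup>2) (at 0)"
    by (intro tendsto_intros)+
  from tendsto_le[OF _ this(2,1) K] have a: "a = 0" by simp
  have K': "eventually (\<lambda>e. \<bar>b + c * e\<bar> \<le> K * \<bar>e\<bar>) (at 0)"
    using K eventually_neq_at_within[of 0 0 UNIV]
  proof eventually_elim
    case (elim e)
    have "\<bar>b + c * e\<bar> * \<bar>e\<bar> = \<bar>a + b * e + c * e\<^sup>2\<bar>"
      by (simp add: a abs_mult[symmetric] power2_eq_square algebra_simps)
    also have "\<dots> \<le> K * \<bar>e\<bar> * \<bar>e\<bar>"
      using elim(1) by (simp add: power2_eq_square mult.assoc)
    finally show ?case
      by (rule mult_right_le_imp_le) (use elim(2) in simp)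
  qed
  have "((\<lambda>e. \<bar>b + c * e\<bar>) \<longlongrightarrow> \<bar>b + c * 0\<bar>) (at 0)"
    "((\<lambda>e. K * \<bar>e\<bar>) \<longlongrightarrow> K * \<bar>0\<bar>) (at (0::real))"
    by (intro tendsto_intros)+
  from tendsto_le[OF _ this(2,1) K'] have "b = 0" by simp
  with a show "a = 0 \<and> b = 0" ..
qed auto

lemma BGI_symmetry_iff_determining:
  "BGI_symmetry (X0, X1) \<longleftrightarrow> point_generator X0 \<and> point_generator X1 \<and>
    (\<forall>x y y1. determining X0 x y y1 = 0) \<and>
    (\<forall>x y y1. determining X1 x y y1 =
      fst X0 x y + 2 * y * snd X0 x y - (x + 1 + y\<^sup>2) * acceleration_coeff X0 x y y1)"
proof -
  let ?g = "\<lambda>x y :: real. x + 1 + y\<^sup>2"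
  let ?m = "\<lambda>X x y y1. ?g x y * acceleration_coeff X x y y1 - fst X x y - 2 * y * snd X x y"
  have expand: "(let F = (\<lambda>x y y1 y2. F0 x y y1 y2 + \<epsilon> * F1 x y y1 y2);
            y2 = - y + \<epsilon> * ?g x y
        in prolong2 X0 F x y y1 y2 + \<epsilon> * prolong2 X1 F x y y1 y2)
      = determining X0 x y y1 + (?m X0 x y y1 + determining X1 x y y1) * \<epsilon> + ?m X1 x y y1 * \<epsilon>\<^sup>2"
    for \<epsilon> x y y1
    unfolding Let_def prolong2_perturbed by (simp add: algebra_simps power2_eq_square)
  have "?m X0 x y y1 + determining X1 x y y1 = 0 \<longleftrightarrow> determining X1 x y y1 =
      fst X0 x y + 2 * y * snd X0 x y - ?g x y * acceleration_coeff X0 x y y1" for x y y1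
    by linarith
  then show ?thesis
    unfolding BGI_symmetry_def fst_conv snd_conv expand quadratic_bigo_square_iff by blast
qed


section \<open>Classification\<close>

lemma point_symmetry0_iff:
  "point_symmetry0 X \<longleftrightarrow>
    (\<exists>a1 a2 a3 a4 a5 a6 a7 a8. X = sol_field 0 0 0 a1 a2 a3 a4 a5 a6 a7 a8)"
proof -
  have "(\<forall>x y y1. determining X x y y1 = 0) \<longleftrightarrow>
      (\<exists>a1 a2 a3 a4 a5 a6 a7 a8. X = sol_field 0 0 0 a1 a2 a3 a4 a5 a6 a7 a8)"
    if "point_generator X"
    using determining_eq_iff_sol_field[OF that, of 0 0 0] by simp
  then show ?thesis
    unfolding point_symmetry0_iff_determining using point_generator_sol_field by blast
qed

lemma sol_field_constant_xi:
  "sol_field 0 0 0 0 0 0 0 c5 c6 c7 0 = (\<lambda>x y. c5, \<lambda>x y. c6 * sin x + c7 * cos x)"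
  by (simp add: sol_field_def)

text \<open>Comparing powers of \<open>y\<close> on both sides of the first-order equation kills the coordinates
  \<open>b1, b2, b3, b4, b8\<close> of \<open>X0\<close>: the term \<open>y\<^sup>2\<close> in \<open>F1\<close> contributes powers of \<open>y\<close> that \<open>D(X1)\<close>
  cannot match.\<close>

lemma BGI_symmetry_iff:
  "BGI_symmetry (X0, X1) \<longleftrightarrow>
    (\<exists>c5 c6 c7 a1 a2 a3 a4 a5 a6 a7 a8.
      X0 = (\<lambda>x y. c5, \<lambda>x y. c6 * sin x + c7 * cos x) \<and>
      X1 = sol_field c5 c6 c7 a1 a2 a3 a4 a5 a6 a7 a8)"
proof
  assume "BGI_symmetry (X0, X1)"
  then have gen: "point_generator X0" "point_generator X1"
    and det0: "\<And>x y y1. determining X0 x y y1 = 0"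
    and det1: "\<And>x y y1. determining X1 x y y1 =
      fst X0 x y + 2 * y * snd X0 x y - (x + 1 + y\<^sup>2) * acceleration_coeff X0 x y y1"
    unfolding BGI_symmetry_iff_determining by blast+
  obtain b1 b2 b3 b4 b5 b6 b7 b8 where X0: "X0 = sol_field 0 0 0 b1 b2 b3 b4 b5 b6 b7 b8"
    using determining_eq_iff_sol_field[OF gen(1), of 0 0 0] det0 by auto
  let ?p = "\<lambda>x. b6 * sin x + b7 * cos x"
  let ?q = "\<lambda>x. b3 * cos (2 * x) + b4 * sin (2 * x)"
  let ?b = "\<lambda>x. b2 * sin x - b1 * cos x"
  let ?r = "\<lambda>x. b2 * cos x + b1 * sin x"
  have eq: "determining X1 x y y1 =
      (fst X0 x y + 2 * y * snd X0 x y - (x + 1 + y\<^sup>2) * (b8 - 3 * ?q x))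
      + y1 * (3 * (x + 1 + y\<^sup>2) * ?b x)" for x y y1
    unfolding det1 unfolding X0 acceleration_coeff_sol_field by (simp add: algebra_simps)
  note nf = determining_affine_imp_quadratic(2,3)[OF gen(2) eq]
  \<comment> \<open>the coefficient of \<open>y'\<close> in \<open>D(X1)\<close> has no \<open>y\<^sup>2\<close> term\<close>
  have b: "?b x = 0" for x
  proof -
    obtain u v where "\<And>y. 3 * (x + 1 + y\<^sup>2) * ?b x = u + 3 * y * v"
      using nf(2)[of x] by blast
    then have "3 * (x + 1) * ?b x + y * 0 + y\<^sup>2 * (3 * ?b x) = u + y * (3 * v) + y\<^sup>2 * 0" for y
      by (simp add: algebra_simps)
    from quadratic_eq_quadratic(3)[OF this] show ?thesis by simp
  qed
  from b[of 0] b[of "pi/2"] have b12: "b1 = 0" "b2 = 0" by simp_all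
  let ?B = "xi_coeff1 X1"
  have B2: "deriv (deriv ?B) = (\<lambda>x. - ?B x)"
  proof
    fix x
    show "deriv (deriv ?B) x = - ?B x"
      using nf(2)[of x 0] nf(2)[of x 1] by (simp add: b)
  qed
  \<comment> \<open>the left-hand side is the \<open>y\<^sup>2\<close> coefficient of the part of \<open>D(X1)\<close> free of \<open>y'\<close>\<close>
  have B3: "deriv (deriv (deriv ?B)) x + deriv ?B x = 0" for x
    using DERIV_imp_deriv[OF DERIV_minus[OF taylor_coeff_derivs(1)[OF gen(2), of ?B x]]]
    unfolding B2 by simp
  have snd_X0: "snd X0 x y = ?p x + y * (?q x + b8)"
    and fst_X0: "fst X0 x y = b3 * sin (2 * x) - b4 * cos (2 * x) + b5" for x y
    by (simp_all add: X0 sol_field_def b12 algebra_simps)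
  have q: "5 * ?q x + b8 = 0" for x
  proof -
    obtain u v where "\<And>y. fst X0 x y + 2 * y * snd X0 x y - (x + 1 + y\<^sup>2) * (b8 - 3 * ?q x) =
        u + y * v + y\<^sup>2 * 0"
      using nf(1)[of x] unfolding B3 by blast
    moreover have "fst X0 x y + 2 * y * snd X0 x y - (x + 1 + y\<^sup>2) * (b8 - 3 * ?q x) =
        (fst X0 x 0 - (x + 1) * (b8 - 3 * ?q x)) + y * (2 * ?p x) + y\<^sup>2 * (5 * ?q x + b8)" for y
      unfolding fst_X0 snd_X0 by (simp add: algebra_simps power2_eq_square)
    ultimately have "(fst X0 x 0 - (x + 1) * (b8 - 3 * ?q x)) + y * (2 * ?p x)
        + y\<^sup>2 * (5 * ?q x + b8) = u + y * v + y\<^sup>2 * 0" for y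
      by metis
    then show ?thesis
      by (rule quadratic_eq_quadratic(3))
  qed
  have b348: "b3 = 0" "b4 = 0" "b8 = 0"
    using q[of 0] q[of "pi/2"] q[of "pi/4"] by simp_all
  have X0': "X0 = (\<lambda>x y. b5, \<lambda>x y. b6 * sin x + b7 * cos x)"
    unfolding X0 b12 b348 by (rule sol_field_constant_xi)
  have "\<forall>x y y1. determining X1 x y y1 = b5 + 2 * y * (b6 * sin x + b7 * cos x)"
    unfolding eq b by (simp add: X0' b348)
  then obtain a1 a2 a3 a4 a5 a6 a7 a8 where "X1 = sol_field b5 b6 b7 a1 a2 a3 a4 a5 a6 a7 a8"
    unfolding determining_eq_iff_sol_field[OF gen(2)] by blast
  with X0' show "\<exists>c5 c6 c7 a1 a2 a3 a4 a5 a6 a7 a8.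
      X0 = (\<lambda>x y. c5, \<lambda>x y. c6 * sin x + c7 * cos x) \<and>
      X1 = sol_field c5 c6 c7 a1 a2 a3 a4 a5 a6 a7 a8"
    by blast
next
  assume "\<exists>c5 c6 c7 a1 a2 a3 a4 a5 a6 a7 a8.
      X0 = (\<lambda>x y. c5, \<lambda>x y. c6 * sin x + c7 * cos x) \<and>
      X1 = sol_field c5 c6 c7 a1 a2 a3 a4 a5 a6 a7 a8"
  then obtain c5 c6 c7 a1 a2 a3 a4 a5 a6 a7 a8 where
    X0: "X0 = sol_field 0 0 0 0 0 0 0 c5 c6 c7 0" and
    X1: "X1 = sol_field c5 c6 c7 a1 a2 a3 a4 a5 a6 a7 a8"
    unfolding sol_field_constant_xi by blast
  show "BGI_symmetry (X0, X1)"
    unfolding BGI_symmetry_iff_determining X0 X1 determining_sol_field acceleration_coeff_sol_field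
    using point_generator_sol_field[of 0 0 0 0 0 0 0 c5 c6 c7 0]
    by (simp add: point_generator_sol_field sol_field_constant_xi)
qed


lemma sol_field_linear_combination:
  "sol_field c5 c6 c7 a1 a2 a3 a4 a5 a6 a7 a8 =
    a1 *\<^sub>R X_1 + a2 *\<^sub>R X_2 + a3 *\<^sub>R X_3 + a4 *\<^sub>R X_4
    + a5 *\<^sub>R X_5 + a6 *\<^sub>R X_6 + a7 *\<^sub>R X_7 + a8 *\<^sub>R X_8
    + c5 *\<^sub>R (\<lambda>x y. 0, \<lambda>x y. 1)
    + c6 *\<^sub>R (\<lambda>x y. - (4/3) * cos x, \<lambda>x y. 2/3 * y * sin x)
    + c7 *\<^sub>R (\<lambda>x y. 4/3 * sin x, \<lambda>x y. 2/3 * y * cos x)"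
  by (simp add: sol_field_def X_1_def X_2_def X_3_def X_4_def X_5_def X_6_def X_7_def X_8_def
      scaleR_fun_def fun_eq_iff algebra_simps)

lemma constant_xi_linear_combination:
  "(\<lambda>x y. c5, \<lambda>x y. c6 * sin x + c7 * cos x) = c5 *\<^sub>R X_5 + c6 *\<^sub>R X_6 + c7 *\<^sub>R X_7"
  by (simp add: X_5_def X_6_def X_7_def scaleR_fun_def fun_eq_iff)

lemma point_symmetries_eq_span:
  "{X. point_symmetry0 X} = span {X_1, X_2, X_3, X_4, X_5, X_6, X_7, X_8}"
proof -
  have "X \<in> span {X_1, X_2, X_3, X_4, X_5, X_6, X_7, X_8} \<longleftrightarrow>
      (\<exists>a1 a2 a3 a4 a5 a6 a7 a8. X = sol_field 0 0 0 a1 a2 a3 a4 a5 a6 a7 a8)" for X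
    by (simp add: span_breakdown_eq sol_field_linear_combination diff_eq_eq add_ac
        zero_prod_def[symmetric])
  then show ?thesis
    unfolding point_symmetry0_iff by blast
qed

lemma in_span_mixed_pairs_iff:
  fixes v1 v2 v3 v4 v5 v6 v7 v8 w5 w6 w7 :: "'a :: real_vector" and u5 u6 u7 :: "'b :: real_vector"
  shows "(x, z) \<in> span ({(0, v1), (0, v2), (0, v3), (0, v4), (0, v5), (0, v6), (0, v7), (0, v8)} \<union>
      {(u5, w5), (u6, w6), (u7, w7)}) \<longleftrightarrow>
    (\<exists>c5 c6 c7 a1 a2 a3 a4 a5 a6 a7 a8. x = c5 *\<^sub>R u5 + c6 *\<^sub>R u6 + c7 *\<^sub>R u7 \<and>
      z = a1 *\<^sub>R v1 + a2 *\<^sub>R v2 + a3 *\<^sub>R v3 + a4 *\<^sub>R v4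
        + a5 *\<^sub>R v5 + a6 *\<^sub>R v6 + a7 *\<^sub>R v7 + a8 *\<^sub>R v8
        + c5 *\<^sub>R w5 + c6 *\<^sub>R w6 + c7 *\<^sub>R w7)"
  by (simp add: span_breakdown_eq zero_prod_def diff_eq_eq add_ac)

lemma BGI_symmetries_eq_span:
  "{X. BGI_symmetry X} =
     span ({(0, X_1), (0, X_2), (0, X_3), (0, X_4), (0, X_5), (0, X_6), (0, X_7), (0, X_8)} \<union>
           {(X_5, (\<lambda>x y. 0, \<lambda>x y. 1)),
            (X_6, (\<lambda>x y. - (4/3) * cos x, \<lambda>x y. 2/3 * y * sin x)),
            (X_7, (\<lambda>x y. 4/3 * sin x, \<lambda>x y. 2/3 * y * cos x))})"
    (is "_ = span ?S")
proof -
  have "(X0, X1) \<in> span ?S \<longleftrightarrow> BGI_symmetry (X0, X1)" for X0 X1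
  proof -
    show ?thesis
      unfolding in_span_mixed_pairs_iff BGI_symmetry_iff constant_xi_linear_combination
        sol_field_linear_combination ..
  qed
  then show ?thesis by auto
qed

lemma stabilizable_iff:
  "(\<exists>X1. point_generator X1 \<and> BGI_symmetry (X0, X1)) \<longleftrightarrow>
    (\<exists>c5 c6 c7. X0 = (\<lambda>x y. c5, \<lambda>x y. c6 * sin x + c7 * cos x))"
  unfolding BGI_symmetry_iff using point_generator_sol_field by blast

lemma stability:
  shows "stable_symmetry X_5" "stable_symmetry X_6" "stable_symmetry X_7"
    and "unstable_symmetry X_1" "unstable_symmetry X_2" "unstable_symmetry X_3"
      "unstable_symmetry X_4" "unstable_symmetry X_8"
proof -
  have sym: "point_symmetry0 X" if "X \<in> {X_1, X_2, X_3, X_4, X_5, X_6, X_7, X_8}" for X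
    using span_base[OF that] point_symmetries_eq_span by blast
  have "X_5 = (\<lambda>x y. 1, \<lambda>x y. 0 * sin x + 0 * cos x)"
    "X_6 = (\<lambda>x y. 0, \<lambda>x y. 1 * sin x + 0 * cos x)"
    "X_7 = (\<lambda>x y. 0, \<lambda>x y. 0 * sin x + 1 * cos x)"
    by (simp_all add: X_5_def X_6_def X_7_def)
  then show "stable_symmetry X_5" "stable_symmetry X_6" "stable_symmetry X_7"
    unfolding stable_symmetry_def stabilizable_iff by (blast intro: sym)+
  \<comment> \<open>a stable symmetry has a constant \<open>\<xi>\<close>, so two different values of \<open>\<xi>\<close> refute stability\<close>
  have not_const: "unstable_symmetry X" if "point_symmetry0 X" "fst X x y \<noteq> fst X x' y'" for X x y x' y'
    using that unfolding unstable_symmetry_def stabilizable_iff by auto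
  show "unstable_symmetry X_1"
    by (rule not_const[of _ 0 0 0 1]) (simp_all add: sym, simp add: X_1_def)
  show "unstable_symmetry X_2"
    by (rule not_const[of _ "pi/2" 0 "pi/2" 1]) (simp_all add: sym, simp add: X_2_def)
  show "unstable_symmetry X_3"
    by (rule not_const[of _ 0 0 "pi/4" 0]) (simp_all add: sym, simp add: X_3_def)
  show "unstable_symmetry X_4"
    by (rule not_const[of _ 0 0 "pi/2" 0]) (simp_all add: sym, simp add: X_4_def)
  have "\<not> (\<exists>c5 c6 c7. X_8 = (\<lambda>x y. c5, \<lambda>x y. c6 * sin x + c7 * cos x))"
  proof
    assume "\<exists>c5 c6 c7. X_8 = (\<lambda>x y. c5, \<lambda>x y. c6 * sin x + c7 * cos x)"
    then obtain c6 c7 where "snd X_8 = (\<lambda>x y. c6 * sin x + c7 * cos x)"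
      by (metis snd_conv)
    then have "snd X_8 0 0 = snd X_8 0 1" by simp
    then show False by (simp add: X_8_def)
  qed
  then show "unstable_symmetry X_8"
    unfolding unstable_symmetry_def stabilizable_iff by (simp add: sym)
qed

theorem mainTheorem1:
  shows
    "(\<forall>\<xi>0 \<xi>1 \<eta>0 \<eta>1 :: real \<Rightarrow> real \<Rightarrow> real.
        smooth \<xi>0 \<longrightarrow> smooth \<xi>1 \<longrightarrow> smooth \<eta>0 \<longrightarrow> smooth \<eta>1 \<longrightarrow>
        (BGI_symmetry ((\<xi>0, \<eta>0), (\<xi>1, \<eta>1)) \<longleftrightarrow>
         (\<exists>C5 C6 C7 a1 a2 a3 a4 a5 a6 a7 a8 :: real. \<forall>x y.
            \<xi>0 x y = C5 \<and>
            \<eta>0 x y = C6 * sin x + C7 * cos x \<and>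
            \<xi>1 x y = - a1 * y * cos x + a2 * y * sin x + a3 * sin (2 * x) - a4 * cos (2 * x) + a5
                      - 4 * C6 / 3 * cos x + 4 * C7 / 3 * sin x \<and>
            \<eta>1 x y = a1 * y\<^sup>2 * sin x + a2 * y\<^sup>2 * cos x + a3 * y * cos (2 * x)
                      + a4 * y * sin (2 * x) + a6 * sin x + a7 * cos x + a8 * y
                      + 2 * C6 / 3 * y * sin x + 2 * C7 / 3 * y * cos x + C5)))
     \<and> {X. point_symmetry0 X} = span {X_1, X_2, X_3, X_4, X_5, X_6, X_7, X_8}
     \<and> {X. BGI_symmetry X} =
         span ({(0, X_1), (0, X_2), (0, X_3), (0, X_4), (0, X_5), (0, X_6), (0, X_7), (0, X_8)} \<union>
               {(X_5, (\<lambda>x y. 0, \<lambda>x y. 1)),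
                (X_6, (\<lambda>x y. - (4/3) * cos x, \<lambda>x y. 2/3 * y * sin x)),
                (X_7, (\<lambda>x y. 4/3 * sin x, \<lambda>x y. 2/3 * y * cos x))})
     \<and> stable_symmetry X_5 \<and> stable_symmetry X_6 \<and> stable_symmetry X_7
     \<and> unstable_symmetry X_1 \<and> unstable_symmetry X_2 \<and> unstable_symmetry X_3 \<and> unstable_symmetry X_4 \<and> unstable_symmetry X_8"
proof (intro conjI allI impI stability point_symmetries_eq_span BGI_symmetries_eq_span)
  fix \<xi>0 \<xi>1 \<eta>0 \<eta>1 :: "real \<Rightarrow> real \<Rightarrow> real"
  show "BGI_symmetry ((\<xi>0, \<eta>0), (\<xi>1, \<eta>1)) \<longleftrightarrow>
         (\<exists>C5 C6 C7 a1 a2 a3 a4 a5 a6 a7 a8 :: real. \<forall>x y.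
            \<xi>0 x y = C5 \<and>
            \<eta>0 x y = C6 * sin x + C7 * cos x \<and>
            \<xi>1 x y = - a1 * y * cos x + a2 * y * sin x + a3 * sin (2 * x) - a4 * cos (2 * x) + a5
                      - 4 * C6 / 3 * cos x + 4 * C7 / 3 * sin x \<and>
            \<eta>1 x y = a1 * y\<^sup>2 * sin x + a2 * y\<^sup>2 * cos x + a3 * y * cos (2 * x)
                      + a4 * y * sin (2 * x) + a6 * sin x + a7 * cos x + a8 * y
                      + 2 * C6 / 3 * y * sin x + 2 * C7 / 3 * y * cos x + C5)"
    unfolding BGI_symmetry_iff sol_field_def prod.inject fun_eq_iff all_conj_distrib conj_assoc ..
qed

end
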